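(* Let $1<\alpha\le 2$ and suppose that $A$ is the generator of a discrete $\alpha$-resolvent family $\{\mathcal{S}_\alpha(n)\}_{n\in\mathbb{N}_0}$ on a Banach space $X$. Let $u_0,u_1\in D(A)$. Then the fractional difference equation $$\Delta^{\alpha}u(n)=Au(n+2),\qquad n\in\mathbb{N}_0,$$ with initial conditions $u(0)=u_0$ and $u(1)=u_1$ admits the unique solution $$u(n)=\mathcal{S}_\alpha(n)(I-A)u_0-\alpha\,\mathcal{S}_\alpha(n-1)u_0+\mathcal{S}_\alpha(n-1)(I-A)u_1,\qquad n\in\mathbb{N}_0,$$ where $\mathcal{S}_\alpha(-1):=0$.
   Context: $\mathbb{N}_0=\{0,1,2,\dots\}$; $X$ is a complex Banach space; $\mathcal{B}(X)$ is the space of bounded linear operators on $X$. For $\beta>0$ and $n\in\mathbb{N}_0$, $k^{\beta}(n):=\frac{\Gamma(\beta+n)}{\Gamma(\beta)\Gamma(n+1)}$. For sequences, $(a*v)(n):=\sum_{j=0}^n a(n-j)v(j)$. For $u:\mathbb{N}_0\to X$, $\Delta u(n):=u(n+1)-u(n)$ and $\Delta^2:=\Delta\circ\Delta$. For $1<\alpha<2$, $\Delta^{\alpha}u:=\Delta^2(k^{2-\alpha}*u)$ (Riemann-Liouville fractional difference); for $\alpha=2$, $\Delta^\alpha$ is $\Delta^2$. Let $A$ be a closed linear operator with domain $D(A)\subset X$. A sequence $\{\mathcal{S}_\alpha(n)\}_{n\in\mathbb{N}_0}\subset\mathcal{B}(X)$ is called a discrete $\alpha$-resolvent family generated by $A$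 if: (i) $\mathcal{S}_\alpha(n)x\in D(A)$ and $\mathcal{S}_\alpha(n)Ax=A\mathcal{S}_\alpha(n)x$ for all $n\in\mathbb{N}_0$, $x\in D(A)$; (ii) $(k^\alpha*\mathcal{S}_\alpha)(n)x\in D(A)$ and $\mathcal{S}_\alpha(n)x=k^\alpha(n)x+A(k^\alpha*\mathcal{S}_\alpha)(n)x$ for all $n\in\mathbb{N}_0$, $x\in X$. A solution of the initial value problem is a sequence $u:\mathbb{N}_0\to X$ with $u(n)\in D(A)$ for all $n\in\mathbb{N}_0$ that satisfies the equation for all $n\in\mathbb{N}_0$ and the initial conditions. *)

theory Defs
  imports "HOL-Analysis.Analysis"
begin

text \<open>
  A complex Banach space is a (real) Banach space with a compatible complex scalar
  multiplication; scaleC_of_real ties the two scalar actions together (and yields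
  1 *C x = x), and norm_scaleC makes the norm a complex norm.
\<close>

class complex_banach = banach +
  fixes scaleC :: "complex \<Rightarrow> 'a \<Rightarrow> 'a" (infixr "*\<^sub>C" 75)
  assumes scaleC_add_right: "c *\<^sub>C (x + y) = c *\<^sub>C x + c *\<^sub>C y"
    and scaleC_add_left: "(c + d) *\<^sub>C x = c *\<^sub>C x + d *\<^sub>C x"
    and scaleC_scaleC: "c *\<^sub>C (d *\<^sub>C x) = (c * d) *\<^sub>C x"
    and scaleC_of_real: "complex_of_real r *\<^sub>C x = r *\<^sub>R x"
    and norm_scaleC: "norm (c *\<^sub>C x) = cmod c * norm x"

instantiation complex :: complex_banach
begin

definition scaleC_complex :: "complex \<Rightarrow> complex \<Rightarrow> complex" where
  "scaleC_complex c x = c * x"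

instance
  by standard (simp_all add: scaleC_complex_def algebra_simps norm_mult scaleR_conv_of_real)

end

text \<open>
  An operator with domain is a pair of a set D and a function A whose values
  outside D are irrelevant.
\<close>

definition closed_linear_operator :: "'a::complex_banach set \<Rightarrow> ('a \<Rightarrow> 'a) \<Rightarrow> bool" where
  "closed_linear_operator D A \<longleftrightarrow>
     0 \<in> D \<and>
     (\<forall>x\<in>D. \<forall>y\<in>D. x + y \<in> D \<and> A (x + y) = A x + A y) \<and>
     (\<forall>c. \<forall>x\<in>D. c *\<^sub>C x \<in> D \<and> A (c *\<^sub>C x) = c *\<^sub>C A x) \<and>
     closed {(x, A x) | x. x \<in> D}"

text \<open>
  The elements of the library type \<open>'a \<Rightarrow>\<^sub>L 'a\<close> are bounded real-linear maps; this
  predicate cuts out the bounded complex-linear ones.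
\<close>

definition complex_linear_blinfun :: "('a::complex_banach \<Rightarrow>\<^sub>L 'a) \<Rightarrow> bool" where
  "complex_linear_blinfun T \<longleftrightarrow>
     (\<forall>c x. blinfun_apply T (c *\<^sub>C x) = c *\<^sub>C blinfun_apply T x)"

definition kern :: "real \<Rightarrow> nat \<Rightarrow> real" where
  "kern \<beta> n = Gamma (\<beta> + real n) / (Gamma \<beta> * Gamma (real n + 1))"

definition conv :: "(nat \<Rightarrow> real) \<Rightarrow> (nat \<Rightarrow> 'a::real_vector) \<Rightarrow> nat \<Rightarrow> 'a" where
  "conv a v n = (\<Sum>j=0..n. a (n - j) *\<^sub>R v j)"

definition fwd_diff :: "(nat \<Rightarrow> 'a::real_vector) \<Rightarrow> nat \<Rightarrow> 'a" where
  "fwd_diff u n = u (n + 1) - u n"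

text \<open>
  Riemann--Liouville fractional difference of order \<open>1 < \<alpha> \<le> 2\<close>.  The case
  \<open>\<alpha> = 2\<close> is separate because \<open>kern 0\<close> would involve the pole of Gamma at 0.
\<close>

definition frac_diff :: "real \<Rightarrow> (nat \<Rightarrow> 'a::real_vector) \<Rightarrow> nat \<Rightarrow> 'a" where
  "frac_diff \<alpha> u =
     (if \<alpha> = 2 then fwd_diff (fwd_diff u)
      else fwd_diff (fwd_diff (conv (kern (2 - \<alpha>)) u)))"

definition discrete_resolvent_family ::
  "real \<Rightarrow> 'a::complex_banach set \<Rightarrow> ('a \<Rightarrow> 'a) \<Rightarrow> (nat \<Rightarrow> 'a \<Rightarrow>\<^sub>L 'a) \<Rightarrow> bool" where
  "discrete_resolvent_family \<alpha> D A S \<longleftrightarrow>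
     (\<forall>n. complex_linear_blinfun (S n)) \<and>
     (\<forall>n. \<forall>x\<in>D. blinfun_apply (S n) x \<in> D \<and>
        blinfun_apply (S n) (A x) = A (blinfun_apply (S n) x)) \<and>
     (\<forall>n x. blinfun_apply (conv (kern \<alpha>) S n) x \<in> D \<and>
        blinfun_apply (S n) x =
          kern \<alpha> n *\<^sub>R x + A (blinfun_apply (conv (kern \<alpha>) S n) x))"

definition is_solution ::
  "real \<Rightarrow> 'a::complex_banach set \<Rightarrow> ('a \<Rightarrow> 'a) \<Rightarrow> 'a \<Rightarrow> 'a \<Rightarrow> (nat \<Rightarrow> 'a) \<Rightarrow> bool" where
  "is_solution \<alpha> D A u0 u1 u \<longleftrightarrow>
     (\<forall>n. u n \<in> D) \<and>
     (\<forall>n. frac_diff \<alpha> u n = A (u (n + 2))) \<and>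
     u 0 = u0 \<and> u 1 = u1"

text \<open>\<open>pred_seq S n\<close> is \<open>S (n - 1)\<close> under the convention \<open>S (-1) = 0\<close>.\<close>

definition pred_seq :: "(nat \<Rightarrow> 'b::zero) \<Rightarrow> nat \<Rightarrow> 'b" where
  "pred_seq S n = (case n of 0 \<Rightarrow> 0 | Suc m \<Rightarrow> S m)"

end

theory Submission
  imports Defs
begin

text \<open>
  Everything rests on the one-parameter convolution group of the Cesaro numbers
  \<open>c \<beta> n = pochhammer \<beta> n / fact n\<close>, the power series coefficients of
  \<open>(1 - z) powr (- \<beta>)\<close>.  They extend the kernel of the problem to all real \<open>\<beta>\<close>, satisfy
  \<open>c \<beta> * c \<gamma> = c (\<beta> + \<gamma>)\<close> (\<open>cesaro_convolution\<close>), and \<open>c 0\<close> is the unit of convolution.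
  The forward difference is convolution with \<open>c (- 1)\<close>, up to an index shift, so for all
  \<open>1 < \<alpha> \<le> 2\<close> the fractional difference at \<open>n\<close> is \<open>(c (- \<alpha>) * u) (n + 2)\<close>
  (\<open>frac_diff_eq_conv\<close>).

  The equation thus reads \<open>(c (- \<alpha>) * u) (n + 2) = A (u (n + 2))\<close>.  Convolving the resolvent
  equation \<open>S = c \<alpha> x + A (c \<alpha> * S)\<close> with the inverse \<open>c (- \<alpha>)\<close> of \<open>c \<alpha>\<close> gives
  \<open>(c (- \<alpha>) * S) (n) x = A S(n) x\<close> for \<open>n \<ge> 1\<close> (\<open>resolvent_difference_equation\<close>).
  So every combination of orbits of \<open>S\<close> and orbits of \<open>S\<close> delayed by one step solves the
  equation, and only the initial values remain to be adjusted.

  At index 0 the resolvent equation says that \<open>I - A : D \<rightarrow> X\<close> is invertible with inverse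
  \<open>S 0\<close>, and at index 1 that \<open>(I - A) S(1) = \<alpha> S(0)\<close>.  The first gives \<open>u(0) = u0\<close>; together
  they give \<open>u(1) = u1\<close>, the term \<open>- \<alpha> S(n - 1) u0\<close> cancelling the contribution of \<open>u0\<close>.
  Uniqueness holds because \<open>c (- \<alpha>) 0 = 1\<close>: the equation determines \<open>(I - A) u(n + 2)\<close> from
  the earlier values, and \<open>I - A\<close> is injective.
\<close>

section \<open>Cesaro numbers and convolution\<close>

definition cesaro :: "real \<Rightarrow> nat \<Rightarrow> real" where
  "cesaro \<beta> n = pochhammer \<beta> n / fact n"

lemma cesaro_at_0 [simp]: "cesaro \<beta> 0 = 1"
  by (simp add: cesaro_def)

lemma cesaro_at_1 [simp]: "cesaro \<beta> (Suc 0) = \<beta>"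
  by (simp add: cesaro_def)

lemma cesaro_zero: "cesaro 0 n = (if n = 0 then 1 else 0)"
  by (simp add: cesaro_def pochhammer_0_left)

lemma cesaro_minus_one: "cesaro (-1) n = (if n = 0 then 1 else if n = 1 then -1 else 0)"
proof (cases "n \<le> 1")
  case True
  then show ?thesis by (cases n) auto
next
  case False
  then have "pochhammer (- of_nat 1 :: real) n = 0"
    by (intro pochhammer_of_nat_eq_0_lemma) simp
  with False show ?thesis by (simp add: cesaro_def)
qed

lemma kern_eq_cesaro:
  assumes "\<beta> > 0"
  shows "kern \<beta> = cesaro \<beta>"
proof
  fix n
  have "\<beta> \<notin> \<int>\<^sub>\<le>\<^sub>0"
    using assms nonpos_Ints_nonpos by fastforce
  moreover have "Gamma (real n + 1) = fact n"
    by (metis Gamma_fact add.commute)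
  ultimately show "kern \<beta> n = cesaro \<beta> n"
    by (simp add: kern_def cesaro_def pochhammer_Gamma)
qed

text \<open>
  The Vandermonde identity for rising factorials, that is, the law of exponents for the powers
  of \<open>1 - z\<close>.
\<close>

lemma cesaro_convolution: "conv (cesaro \<beta>) (cesaro \<gamma>) = cesaro (\<beta> + \<gamma>)"
proof
  fix n
  have "cesaro (\<beta> + \<gamma>) n = cesaro (\<gamma> + \<beta>) n"
    by (simp add: add.commute)
  also have "\<dots> = (\<Sum>j\<le>n. real (n choose j) * pochhammer \<gamma> j * pochhammer \<beta> (n - j) / fact n)"
    by (simp add: cesaro_def pochhammer_binomial_sum sum_divide_distrib)
  also have "\<dots> = (\<Sum>j\<le>n. cesaro \<beta> (n - j) * cesaro \<gamma> j)"
    by (intro sum.cong refl) (simp add: cesaro_def binomial_fact field_simps)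
  finally show "conv (cesaro \<beta>) (cesaro \<gamma>) n = cesaro (\<beta> + \<gamma>) n"
    by (simp add: conv_def atMost_atLeast0)
qed

lemma conv_assoc: "conv a (conv b v) = conv (conv a b) v"
proof
  fix n
  have "conv a (conv b v) n = (\<Sum>j=0..n. \<Sum>i=0..j. a (n - j) *\<^sub>R b (j - i) *\<^sub>R v i)"
    by (simp add: conv_def scaleR_sum_right)
  also have "\<dots> = (\<Sum>j=0..n. \<Sum>i=0..n - j. a (n - j - i) *\<^sub>R b i *\<^sub>R v j)"
    by (rule fps_mult_assoc_lemma[where f = "\<lambda>p q r. a r *\<^sub>R b q *\<^sub>R v p"])
  also have "\<dots> = conv (conv a b) v n"
    by (simp add: conv_def scaleR_sum_left)
  finally show "conv a (conv b v) n = conv (conv a b) v n" .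
qed

lemma conv_cesaro_cesaro: "conv (cesaro \<beta>) (conv (cesaro \<gamma>) v) = conv (cesaro (\<beta> + \<gamma>)) v"
  by (simp add: conv_assoc cesaro_convolution)

lemma conv_cesaro_zero: "conv (cesaro 0) v = v"
proof
  fix n
  have "conv (cesaro 0) v n = (\<Sum>j=0..n. if j = n then v j else 0)"
    unfolding conv_def by (intro sum.cong refl) (auto simp: cesaro_zero)
  then show "conv (cesaro 0) v n = v n" by simp
qed

lemma conv_add: "conv a (\<lambda>j. v j + w j) n = conv a v n + conv a w n"
  by (simp add: conv_def scaleR_add_right sum.distrib)

lemma conv_diff: "conv a (\<lambda>j. v j - w j) n = conv a v n - conv a w n"
  by (simp add: conv_def scaleR_diff_right sum_subtractf)

lemma conv_scaleR_right: "conv a (\<lambda>j. r *\<^sub>R v j) n = r *\<^sub>R conv a v n"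
  by (simp add: conv_def scaleR_sum_right mult.commute)

lemma conv_scaleR_left: "conv a (\<lambda>j. b j *\<^sub>R x) n = conv a b n *\<^sub>R x"
  by (simp add: conv_def scaleR_sum_left)

lemma conv_split_last: "conv a v (Suc n) = (\<Sum>j=0..n. a (Suc n - j) *\<^sub>R v j) + a 0 *\<^sub>R v (Suc n)"
  by (simp add: conv_def)

lemma conv_pred_seq: "conv a (pred_seq v) (Suc n) = conv a v n"
  by (simp add: conv_def sum.atLeast0_atMost_Suc_shift pred_seq_def del: sum.cl_ivl_Suc)

lemma blinfun_apply_conv: "blinfun_apply (conv a S n) x = conv a (\<lambda>j. blinfun_apply (S j) x) n"
  by (simp add: conv_def blinfun.sum_left blinfun.scaleR_left)

lemma blinfun_apply_pred_seq:
  "blinfun_apply (pred_seq S n) x = pred_seq (\<lambda>j. blinfun_apply (S j) x) n"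
  by (simp add: pred_seq_def split: nat.split)

section \<open>The fractional difference as a convolution\<close>

lemma conv_cesaro_minus_one: "conv (cesaro (-1)) v (Suc n) = fwd_diff v n"
proof -
  have "(\<Sum>j=0..n. cesaro (-1) (Suc n - j) *\<^sub>R v j) = (\<Sum>j=0..n. if j = n then - v j else 0)"
    by (intro sum.cong refl) (auto simp: cesaro_minus_one)
  then show ?thesis
    by (simp add: conv_split_last fwd_diff_def)
qed

lemma fwd_diff_twice: "fwd_diff (fwd_diff v) n = conv (cesaro (-2)) v (n + 2)"
proof -
  have "fwd_diff (fwd_diff v) n = fwd_diff v (Suc n) - fwd_diff v n"
    by (simp add: fwd_diff_def)
  also have "\<dots> = fwd_diff (conv (cesaro (-1)) v) (Suc n)"
    by (simp add: fwd_diff_def[of "conv (cesaro (-1)) v"] conv_cesaro_minus_one)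
  also have "\<dots> = conv (cesaro (-1)) (conv (cesaro (-1)) v) (n + 2)"
    by (simp add: conv_cesaro_minus_one)
  finally show ?thesis
    by (simp add: conv_cesaro_cesaro)
qed

text \<open>
  The smoothing by \<open>c (2 - \<alpha>)\<close> and the two differences \<open>c (- 2)\<close> merge into \<open>c (- \<alpha>)\<close>.  At
  \<open>\<alpha> = 2\<close> the smoothing is the unit \<open>c 0\<close>, so that case has the same form.
\<close>

lemma frac_diff_eq_conv:
  assumes "\<alpha> \<le> 2"
  shows "frac_diff \<alpha> u n = conv (cesaro (- \<alpha>)) u (n + 2)"
proof (cases "\<alpha> = 2")
  case True
  then show ?thesis by (simp add: frac_diff_def fwd_diff_twice)
next
  case False
  with assms have "kern (2 - \<alpha>) = cesaro (2 - \<alpha>)"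
    by (intro kern_eq_cesaro) simp
  with False show ?thesis
    by (simp add: frac_diff_def fwd_diff_twice conv_cesaro_cesaro)
qed

section \<open>Operators with domain\<close>

text \<open>
  Linearity over the reals is the form that fits convolution with the real kernels \<open>c \<beta>\<close>.
\<close>

definition real_linear_on :: "'a::real_vector set \<Rightarrow> ('a \<Rightarrow> 'a) \<Rightarrow> bool" where
  "real_linear_on D A \<longleftrightarrow> 0 \<in> D \<and>
     (\<forall>x\<in>D. \<forall>y\<in>D. x + y \<in> D \<and> A (x + y) = A x + A y) \<and>
     (\<forall>r. \<forall>x\<in>D. r *\<^sub>R x \<in> D \<and> A (r *\<^sub>R x) = r *\<^sub>R A x)"

lemma closed_linear_operator_real_linear:
  assumes "closed_linear_operator D A"
  shows "real_linear_on D A"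
  using assms unfolding closed_linear_operator_def real_linear_on_def
  by (metis scaleC_of_real)

context
  fixes D :: "'a::real_vector set" and A :: "'a \<Rightarrow> 'a"
  assumes lin: "real_linear_on D A"
begin

lemma dom_zero: "0 \<in> D"
  using lin by (simp add: real_linear_on_def)

lemma dom_add: "x \<in> D \<Longrightarrow> y \<in> D \<Longrightarrow> x + y \<in> D"
  using lin by (simp add: real_linear_on_def)

lemma dom_scaleR: "x \<in> D \<Longrightarrow> r *\<^sub>R x \<in> D"
  using lin by (simp add: real_linear_on_def)

lemma dom_diff: "x \<in> D \<Longrightarrow> y \<in> D \<Longrightarrow> x - y \<in> D"
  using dom_add[of x "(-1) *\<^sub>R y"] dom_scaleR[of y "-1"] by simp

lemma op_add: "x \<in> D \<Longrightarrow> y \<in> D \<Longrightarrow> A (x + y) = A x + A y"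
  using lin by (simp add: real_linear_on_def)

lemma op_scaleR: "x \<in> D \<Longrightarrow> A (r *\<^sub>R x) = r *\<^sub>R A x"
  using lin by (simp add: real_linear_on_def)

lemma op_zero: "A 0 = 0"
  using op_scaleR[OF dom_zero, of 0] by simp

lemma op_diff: "x \<in> D \<Longrightarrow> y \<in> D \<Longrightarrow> A (x - y) = A x - A y"
  using op_add[of x "(-1) *\<^sub>R y"] dom_scaleR[of y "-1"] op_scaleR[of y "-1"] by simp

lemma dom_sum: "(\<And>i. i \<in> I \<Longrightarrow> f i \<in> D) \<Longrightarrow> sum f I \<in> D"
  by (induction I rule: infinite_finite_induct) (auto intro: dom_zero dom_add)

lemma op_sum: "(\<And>i. i \<in> I \<Longrightarrow> f i \<in> D) \<Longrightarrow> A (sum f I) = (\<Sum>i\<in>I. A (f i))"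
  by (induction I rule: infinite_finite_induct) (auto simp: op_zero op_add dom_sum)

lemma op_conv: "(\<And>j. v j \<in> D) \<Longrightarrow> A (conv a v n) = conv a (\<lambda>j. A (v j)) n"
  by (simp add: conv_def op_sum op_scaleR dom_scaleR)

end

section \<open>Discrete resolvent families\<close>

context
  fixes \<alpha> :: real and D :: "'a::complex_banach set" and A :: "'a \<Rightarrow> 'a"
    and S :: "nat \<Rightarrow> 'a \<Rightarrow>\<^sub>L 'a"
  assumes alpha: "1 < \<alpha>"
    and lin: "real_linear_on D A"
    and res: "discrete_resolvent_family \<alpha> D A S"
begin

lemma resolvent_commutes: "x \<in> D \<Longrightarrow> blinfun_apply (S n) (A x) = A (blinfun_apply (S n) x)"
  using res unfolding discrete_resolvent_family_def by blast

lemma resolvent_conv_dom: "conv (cesaro \<alpha>) (\<lambda>j. blinfun_apply (S j) x) n \<in> D"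
  and resolvent_equation: "blinfun_apply (S n) x =
    cesaro \<alpha> n *\<^sub>R x + A (conv (cesaro \<alpha>) (\<lambda>j. blinfun_apply (S j) x) n)"
proof -
  have kern: "kern \<alpha> = cesaro \<alpha>"
    using alpha by (simp add: kern_eq_cesaro)
  show "conv (cesaro \<alpha>) (\<lambda>j. blinfun_apply (S j) x) n \<in> D"
    and "blinfun_apply (S n) x =
      cesaro \<alpha> n *\<^sub>R x + A (conv (cesaro \<alpha>) (\<lambda>j. blinfun_apply (S j) x) n)"
    using res unfolding discrete_resolvent_family_def blinfun_apply_conv kern by blast+
qed

lemma resolvent_eq_conv_conv: "blinfun_apply (S n) x =
    conv (cesaro (- \<alpha>)) (conv (cesaro \<alpha>) (\<lambda>j. blinfun_apply (S j) x)) n"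
  by (simp add: conv_cesaro_cesaro conv_cesaro_zero)

text \<open>
  Deconvolution writes \<open>S n x\<close> as a finite combination of the values of \<open>c \<alpha> * S\<close>, which the
  definition of the family puts into the domain for every \<open>x\<close>.
\<close>

lemma resolvent_in_dom: "blinfun_apply (S n) x \<in> D"
proof -
  have "conv (cesaro (- \<alpha>)) (conv (cesaro \<alpha>) (\<lambda>j. blinfun_apply (S j) x)) n \<in> D"
    unfolding conv_def[of "cesaro (- \<alpha>)"]
    by (intro dom_sum[OF lin] dom_scaleR[OF lin] resolvent_conv_dom)
  then show ?thesis
    by (simp only: resolvent_eq_conv_conv[symmetric])
qed

text \<open>
  Convolving the resolvent equation with \<open>c (- \<alpha>)\<close> turns \<open>c \<alpha>\<close> into the unit \<open>c 0\<close>, which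
  vanishes at positive indices.
\<close>

lemma resolvent_difference_equation:
  assumes "n > 0"
  shows "conv (cesaro (- \<alpha>)) (\<lambda>j. blinfun_apply (S j) x) n = A (blinfun_apply (S n) x)"
proof -
  let ?w = "conv (cesaro \<alpha>) (\<lambda>j. blinfun_apply (S j) x)"
  have "conv (cesaro (- \<alpha>)) (\<lambda>j. blinfun_apply (S j) x) n
      = conv (cesaro (- \<alpha>)) (\<lambda>j. cesaro \<alpha> j *\<^sub>R x + A (?w j)) n"
    by (rule arg_cong[where f = "\<lambda>v. conv (cesaro (- \<alpha>)) v n"]) (rule ext, rule resolvent_equation)
  also have "\<dots> = cesaro 0 n *\<^sub>R x + conv (cesaro (- \<alpha>)) (\<lambda>j. A (?w j)) n"
    by (simp add: conv_add conv_scaleR_left cesaro_convolution)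
  also have "\<dots> = conv (cesaro (- \<alpha>)) (\<lambda>j. A (?w j)) n"
    using assms by (simp add: cesaro_zero)
  also have "\<dots> = A (conv (cesaro (- \<alpha>)) ?w n)"
    by (rule op_conv[OF lin, symmetric]) (rule resolvent_conv_dom)
  finally show ?thesis
    by (simp only: resolvent_eq_conv_conv[symmetric])
qed

lemma resolvent_left_inverse:
  assumes "x \<in> D"
  shows "blinfun_apply (S 0) (x - A x) = x"
proof -
  have "blinfun_apply (S 0) x = x + A (blinfun_apply (S 0) x)"
    using resolvent_equation[of 0 x] by (simp add: conv_def)
  then have "blinfun_apply (S 0) x - A (blinfun_apply (S 0) x) = x"
    by (metis add_diff_cancel_right')
  then show ?thesis
    using assms by (simp add: blinfun.diff_right resolvent_commutes)
qed

lemma one_minus_op_injective: "x \<in> D \<Longrightarrow> y \<in> D \<Longrightarrow> x - A x = y - A y \<Longrightarrow> x = y"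
  by (metis resolvent_left_inverse)

text \<open>
  This is the difference equation at index 1, where \<open>c (- \<alpha>)\<close> takes the values \<open>1\<close> and \<open>- \<alpha>\<close>.
\<close>

lemma resolvent_at_1:
  assumes "x \<in> D"
  shows "blinfun_apply (S 1) (x - A x) = \<alpha> *\<^sub>R blinfun_apply (S 0) x"
proof -
  have "blinfun_apply (S 1) x - \<alpha> *\<^sub>R blinfun_apply (S 0) x = A (blinfun_apply (S 1) x)"
    using resolvent_difference_equation[of 1 x] by (simp add: conv_def)
  then show ?thesis
    using assms by (simp add: blinfun.diff_right resolvent_commutes algebra_simps)
qed

lemma solution_unique:
  assumes "\<alpha> \<le> 2" and u: "is_solution \<alpha> D A u0 u1 u" and v: "is_solution \<alpha> D A u0 u1 v"
  shows "u = v"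
proof
  fix n
  show "u n = v n"
  proof (induction n rule: less_induct)
    case (less n)
    show ?case
    proof (cases "n < 2")
      case True
      then have "n = 0 \<or> n = 1" by auto
      with u v show ?thesis unfolding is_solution_def by metis
    next
      case False
      then obtain m where n: "n = m + 2"
        by (metis add.commute le_Suc_ex not_less)
      have move_sum: "y - a = - s" if "s + y = a" for s y a :: 'a
        using that by auto
      \<comment> \<open>The equation at \<open>m\<close>, with the leading term of the convolution moved to the left.\<close>
      have step: "w n - A (w n) = - (\<Sum>j=0..m + 1. cesaro (- \<alpha>) (n - j) *\<^sub>R w j)"
        if "is_solution \<alpha> D A u0 u1 w" for w
      proof -
        have "frac_diff \<alpha> w m = A (w (m + 2))"
          using that unfolding is_solution_def by blast
        then have "conv (cesaro (- \<alpha>)) w (Suc (m + 1)) = A (w n)"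
          by (simp add: frac_diff_eq_conv[OF assms(1)] n)
        then have "(\<Sum>j=0..m + 1. cesaro (- \<alpha>) (n - j) *\<^sub>R w j) + w n = A (w n)"
          unfolding conv_split_last n by simp
        then show ?thesis
          by (rule move_sum)
      qed
      have "(\<Sum>j=0..m + 1. cesaro (- \<alpha>) (n - j) *\<^sub>R u j)
          = (\<Sum>j=0..m + 1. cesaro (- \<alpha>) (n - j) *\<^sub>R v j)"
        by (intro sum.cong refl) (subst less.IH, simp_all add: n)
      then have "u n - A (u n) = v n - A (v n)"
        unfolding step[OF u] step[OF v] by (rule arg_cong)
      moreover have "u n \<in> D" "v n \<in> D"
        using u v unfolding is_solution_def by blast+
      ultimately show ?thesis
        by (blast intro: one_minus_op_injective)
    qed
  qed
qed

lemma formula_is_solution: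
  assumes "\<alpha> \<le> 2" and u0: "u0 \<in> D" and u1: "u1 \<in> D"
  shows "is_solution \<alpha> D A u0 u1
      (\<lambda>n. blinfun_apply (S n) (u0 - A u0)
           - \<alpha> *\<^sub>R blinfun_apply (pred_seq S n) u0
           + blinfun_apply (pred_seq S n) (u1 - A u1))"
    (is "is_solution _ _ _ _ _ ?u")
proof -
  have pred_dom: "blinfun_apply (pred_seq S n) x \<in> D" for n x
    by (cases n) (simp_all add: pred_seq_def dom_zero[OF lin] resolvent_in_dom)
  have pred_eq: "conv (cesaro (- \<alpha>)) (\<lambda>j. blinfun_apply (pred_seq S j) x) (Suc (Suc n))
      = A (blinfun_apply (pred_seq S (Suc (Suc n))) x)" for n x
    using resolvent_difference_equation[of "Suc n" x]
    by (simp add: blinfun_apply_pred_seq conv_pred_seq) (simp add: pred_seq_def)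
  have "?u n \<in> D" for n
    by (intro dom_add[OF lin] dom_diff[OF lin] dom_scaleR[OF lin] pred_dom resolvent_in_dom)
  moreover have "frac_diff \<alpha> ?u n = A (?u (n + 2))" for n
    using assms(1)
    by (simp add: frac_diff_eq_conv conv_add conv_diff conv_scaleR_right pred_eq
        resolvent_difference_equation op_add[OF lin] op_diff[OF lin] op_scaleR[OF lin]
        dom_diff[OF lin] dom_scaleR[OF lin] pred_dom resolvent_in_dom)
  moreover have "?u 0 = u0"
    by (simp add: pred_seq_def resolvent_left_inverse[OF u0])
  moreover have "?u 1 = u1"
    using resolvent_at_1[OF u0] resolvent_left_inverse[OF u1] by (simp add: pred_seq_def)
  ultimately show ?thesis
    unfolding is_solution_def by blast
qed

end

section \<open>The initial value problem\<close>

theorem theorem3p5: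
  fixes \<alpha> :: real
    and D :: "'a::complex_banach set"
    and A :: "'a \<Rightarrow> 'a"
    and S :: "nat \<Rightarrow> 'a \<Rightarrow>\<^sub>L 'a"
    and u0 u1 :: 'a
  assumes "1 < \<alpha>" and "\<alpha> \<le> 2"
    and "closed_linear_operator D A"
    and "discrete_resolvent_family \<alpha> D A S"
    and "u0 \<in> D" and "u1 \<in> D"
  shows "(\<exists>!u. is_solution \<alpha> D A u0 u1 u) \<and>
    is_solution \<alpha> D A u0 u1
      (\<lambda>n. blinfun_apply (S n) (u0 - A u0)
           - \<alpha> *\<^sub>R blinfun_apply (pred_seq S n) u0
           + blinfun_apply (pred_seq S n) (u1 - A u1))"
proof -
  note lin = closed_linear_operator_real_linear[OF assms(3)]
  note sol = formula_is_solution[OF assms(1) lin assms(4) assms(2) assms(5,6)]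
  show ?thesis
    by (rule conjI, rule ex1I, rule sol,
        rule solution_unique[OF assms(1) lin assms(4) assms(2) _ sol], assumption, rule sol)
qed

end
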